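(* Let $V:\mathfrak{C}\to\mathfrak{U}$ be a game value map, where $v_T,w_\lambda\in\mathfrak{C}$ for all $T,\lambda>0$. Let a family of functions $U_\lambda\in\mathfrak{U}$ $(\lambda>0)$ be a subsolution for the payoffs $w_\lambda$, and let the family of functions $V[v_T]$ $(T>0)$ be a supersolution for the payoffs $v_T$. Further, let $U_\lambda$ $(\lambda>0)$ satisfy $$\limsup_{\lambda\downarrow0}\ \sup_{p\in[1,p_0]}\ \sup_{\omega\in\Omega}\big(U_\lambda(\omega)-U_{p\lambda}(\omega)\big)\le 0\qquad\forall p_0>1.$$ Then for every $\varepsilon>0$ there exists a natural $N$ such that $$V[v_T](\omega)\ge U_{1/T}(\omega)-\varepsilon\qquad\forall\omega\in\Omega,\ T>N.$$
   Context: Setting: $\mathbb{R}_+=[0,\infty)$. $\Omega$ is a nonempty set; $\mathbb{K}$ is a nonempty set of maps from $\mathbb{R}_+$ to $\Omega$; $g:\Omega\to[0,1]$ is such that for every $z\in\mathbb{K}$ the map $t\mapsto g(z(t))$ is Borel measurable. For $T,\lambda>0$ and $z\in\mathbb{K}$, $$v_T(z)=\frac1T\int_0^T g(z(t))\,dt,\qquad w_\lambda(z)=\lambda\int_0^\infty e^{-\lambda t}g(z(t))\,dt .$$ Game value map: $\mathfrak{U}$ is the set of all bounded maps $\Omega\to\mathbb{R}$. $\mathfrak{C}$ is a nonempty set of maps $\mathbb{K}\to\mathbb{R}$ such that $Ac+B\in\mathfrak{C}$ for all $c\in\mathfrak{C}$, $A\ge0$, $B\in\mathbb{R}$. A map $V:\mathfrak{C}\to\mathfrak{U}$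 is a game value map if (1) $V[Ac+B]=A\,V[c]+B$ for all $c\in\mathfrak{C}$, $A\ge 0$, $B\in\mathbb{R}$; and (2) for $c_1,c_2\in\mathfrak{C}$, if $c_1(z)\le c_2(z)$ for all $z\in\mathbb{K}$ then $V[c_1](\omega)\le V[c_2](\omega)$ for all $\omega\in\Omega$. Auxiliary payoffs: for $\lambda,T,h>0$ and $U_*:\Omega\to\mathbb{R}$, define for $z\in\mathbb{K}$ $$\zeta^{U_*}_{h,T}(z)=\frac{1}{T+h}\int_0^h g(z(t))\,dt+\frac{T}{T+h}U_*(z(h)),\qquad \xi^{U_*}_{h,\lambda}(z)=\lambda\int_0^h e^{-\lambda t}g(z(t))\,dt+e^{-\lambda h}U_*(z(h)).$$ Sub-/supersolutions: A family $U_T\in\mathfrak{U}$ $(T>0)$ is a subsolution (supersolution) for the payoffs $v_T$ $(T>0)$ if for every $\varepsilon>0$ there is a natural $\bar T$ such that for all natural $h,T>\bar T$ the payoff $\zeta^{U_T}_{h,T}$ lies in $\mathfrak{C}$ and $U_{T+h}\le V[\zeta^{U_T}_{h,T}]+\varepsilon$ (respectively $U_{T+h}\ge V[\zeta^{U_T}_{h,T}]-\varepsilon$) on $\Omega$. A family $U_\lambda\in\mathfrak{U}$ $(\lambda>0)$ is a subsolution (supersolution) for the payoffs $w_\lambda$ $(\lambda>0)$ if for every $\varepsilon>0$ there is a natural $\bar T$ such that for all natural $h>\bar T$ and all positive $\lambda<1/\bar T$ the payoff $\xi^{U_\lambda}_{h,\lambda}$ lies in $\mathfrak{C}$ and $U_\lambda\le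 V[\xi^{U_\lambda}_{h,\lambda}]+\varepsilon$ (respectively $U_\lambda\ge V[\xi^{U_\lambda}_{h,\lambda}]-\varepsilon$) on $\Omega$. *)

theory Defs
  imports "HOL-Analysis.Analysis"
begin

text \<open>
  The nonempty set $\Omega$ is the type \<open>'w\<close>.  Maps on $[0,\infty)$ and on the trajectory set
  \<open>K\<close> are represented extensionally, so that two of them are equal iff they agree on their domain.
  Families indexed by positive reals are functions on \<^typ>\<open>real\<close> whose values at nonpositive
  arguments are never used.
\<close>

definition bounded_maps :: "('w \<Rightarrow> real) set" where
  "bounded_maps = {u. bounded (range u)}"

definition payoff_class :: "(real \<Rightarrow> 'w) set \<Rightarrow> ((real \<Rightarrow> 'w) \<Rightarrow> real) set \<Rightarrow> bool" where
  "payoff_class K C \<longleftrightarrow>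
     C \<noteq> {} \<and> C \<subseteq> (K \<rightarrow>\<^sub>E UNIV) \<and>
     (\<forall>c\<in>C. \<forall>A\<ge>0. \<forall>B. (\<lambda>z\<in>K. A * c z + B) \<in> C)"

definition game_value_map ::
  "(real \<Rightarrow> 'w) set \<Rightarrow> ((real \<Rightarrow> 'w) \<Rightarrow> real) set \<Rightarrow>
   (((real \<Rightarrow> 'w) \<Rightarrow> real) \<Rightarrow> 'w \<Rightarrow> real) \<Rightarrow> bool" where
  "game_value_map K C V \<longleftrightarrow>
     V \<in> C \<rightarrow> bounded_maps \<and>
     (\<forall>c\<in>C. \<forall>A\<ge>0. \<forall>B. V (\<lambda>z\<in>K. A * c z + B) = (\<lambda>\<omega>. A * V c \<omega> + B)) \<and>
     (\<forall>c1\<in>C. \<forall>c2\<in>C. (\<forall>z\<in>K. c1 z \<le> c2 z) \<longrightarrow> (\<forall>\<omega>. V c1 \<omega> \<le> V c2 \<omega>))"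

definition cesaro_payoff ::
  "(real \<Rightarrow> 'w) set \<Rightarrow> ('w \<Rightarrow> real) \<Rightarrow> real \<Rightarrow> (real \<Rightarrow> 'w) \<Rightarrow> real" where
  "cesaro_payoff K g T = (\<lambda>z\<in>K. 1 / T * (LBINT t:{0..T}. g (z t)))"

definition abel_payoff ::
  "(real \<Rightarrow> 'w) set \<Rightarrow> ('w \<Rightarrow> real) \<Rightarrow> real \<Rightarrow> (real \<Rightarrow> 'w) \<Rightarrow> real" where
  "abel_payoff K g l = (\<lambda>z\<in>K. l * (LBINT t:{0..}. exp (- l * t) * g (z t)))"

definition cesaro_aux ::
  "(real \<Rightarrow> 'w) set \<Rightarrow> ('w \<Rightarrow> real) \<Rightarrow> ('w \<Rightarrow> real) \<Rightarrow> real \<Rightarrow> real \<Rightarrow> (real \<Rightarrow> 'w) \<Rightarrow> real" where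
  "cesaro_aux K g u h T =
     (\<lambda>z\<in>K. 1 / (T + h) * (LBINT t:{0..h}. g (z t)) + T / (T + h) * u (z h))"

definition abel_aux ::
  "(real \<Rightarrow> 'w) set \<Rightarrow> ('w \<Rightarrow> real) \<Rightarrow> ('w \<Rightarrow> real) \<Rightarrow> real \<Rightarrow> real \<Rightarrow> (real \<Rightarrow> 'w) \<Rightarrow> real" where
  "abel_aux K g u h l =
     (\<lambda>z\<in>K. l * (LBINT t:{0..h}. exp (- l * t) * g (z t)) + exp (- l * h) * u (z h))"

definition cesaro_supersolution ::
  "(real \<Rightarrow> 'w) set \<Rightarrow> ('w \<Rightarrow> real) \<Rightarrow> ((real \<Rightarrow> 'w) \<Rightarrow> real) set \<Rightarrow>
   (((real \<Rightarrow> 'w) \<Rightarrow> real) \<Rightarrow> 'w \<Rightarrow> real) \<Rightarrow> (real \<Rightarrow> 'w \<Rightarrow> real) \<Rightarrow> bool" where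
  "cesaro_supersolution K g C V U \<longleftrightarrow>
     (\<forall>T>0. U T \<in> bounded_maps) \<and>
     (\<forall>\<epsilon>>0. \<exists>Tb::nat. Tb > 0 \<and>
        (\<forall>h T :: nat. h > Tb \<longrightarrow> T > Tb \<longrightarrow>
           cesaro_aux K g (U (real T)) (real h) (real T) \<in> C \<and>
           (\<forall>\<omega>. U (real T + real h) \<omega>
                  \<ge> V (cesaro_aux K g (U (real T)) (real h) (real T)) \<omega> - \<epsilon>)))"

text \<open>Here positivity of \<open>Tb\<close> matters: \<open>1 / 0 = 0\<close> would make the condition on \<open>l\<close> vacuous.\<close>

definition abel_subsolution ::
  "(real \<Rightarrow> 'w) set \<Rightarrow> ('w \<Rightarrow> real) \<Rightarrow> ((real \<Rightarrow> 'w) \<Rightarrow> real) set \<Rightarrow>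
   (((real \<Rightarrow> 'w) \<Rightarrow> real) \<Rightarrow> 'w \<Rightarrow> real) \<Rightarrow> (real \<Rightarrow> 'w \<Rightarrow> real) \<Rightarrow> bool" where
  "abel_subsolution K g C V U \<longleftrightarrow>
     (\<forall>l>0. U l \<in> bounded_maps) \<and>
     (\<forall>\<epsilon>>0. \<exists>Tb::nat. Tb > 0 \<and>
        (\<forall>(h::nat) (l::real). h > Tb \<longrightarrow> 0 < l \<longrightarrow> l < 1 / real Tb \<longrightarrow>
           abel_aux K g (U l) (real h) l \<in> C \<and>
           (\<forall>\<omega>. U l \<omega> \<le> V (abel_aux K g (U l) (real h) l) \<omega> + \<epsilon>)))"

end

theory Submission
  imports Defs
begin

text \<open>
  Let \<open>D\<close> bound \<open>U (1 / T) - V[v_T]\<close> and put \<open>n = T + h\<close>, \<open>q = h / n\<close>.  The dynamic programming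
  inequalities over \<open>[0, h]\<close> with \<open>l = 1 / n\<close> weigh the terminal terms by \<open>exp (- q)\<close> and \<open>1 - q\<close>,
  which differ by at most \<open>q\<^sup>2 / 2\<close>; so \<open>(1 - q) * D + q\<^sup>2\<close> bounds \<open>U (1 / n) - V[v_n]\<close> up to a
  small error.  With \<open>h\<close> close to \<open>n / m\<close>, iteration contracts \<open>D\<close> to a quantity of order \<open>1 / m\<close>.
\<close>

section \<open>Integrals of bounded running payoffs\<close>

lemma set_integrable_weighted:
  fixes f w :: "real \<Rightarrow> real"
  assumes f: "f \<in> borel_measurable (restrict_space borel {0..})"
    and f01: "\<And>t. f t \<in> {0..1}"
    and w: "w \<in> borel_measurable borel"
    and w1: "\<And>t. t \<in> {0..h} \<Longrightarrow> \<bar>w t\<bar> \<le> 1"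
  shows "set_integrable lborel {0..h} (\<lambda>t. w t * f t)"
proof -
  \<comment> \<open>Measurability of \<open>f\<close> is known on the nonnegative half-line only.
    Cutting it off at 0 gives a function that is Borel on the whole line and agrees with
    \<open>f\<close> on \<open>{0..h}\<close>.\<close>
  have m: "(\<lambda>t. indicator {0..} t * f t) \<in> borel_measurable borel"
    using f by (subst (asm) borel_measurable_restrict_space_iff) (auto simp: mult.commute)
  have "integrable lborel (\<lambda>t. indicator {0..h} t *\<^sub>R (w t * (indicator {0..} t * f t)))"
  proof (rule integrableI_bounded_set_indicator[where B = 1])
    show "(\<lambda>t. w t * (indicator {0..} t * f t)) \<in> borel_measurable lborel"
      using m w by simp
    have "\<bar>w t * (indicator {0..} t * f t)\<bar> \<le> 1 * 1" if "t \<in> {0..h}" for t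
      unfolding abs_mult by (rule mult_mono) (use that w1 f01[of t] in \<open>auto simp: indicator_def\<close>)
    then show "AE t in lborel. t \<in> {0..h} \<longrightarrow> norm (w t * (indicator {0..} t * f t)) \<le> 1"
      by auto
  qed (auto simp: emeasure_lborel_Icc_eq)
  moreover have "(\<lambda>t. indicator {0..h} t *\<^sub>R (w t * (indicator {0..} t * f t)))
      = (\<lambda>t. indicator {0..h} t *\<^sub>R (w t * f t))"
    by (auto simp: indicator_def)
  ultimately show ?thesis
    by (simp add: set_integrable_def)
qed

lemma has_bochner_integral_exp_neg_Icc:
  fixes l h :: real
  assumes "l > 0" "h \<ge> 0"
  shows "has_bochner_integral lborel (\<lambda>t. indicator {0..h} t *\<^sub>R exp (- l * t)) ((1 - exp (- l * h)) / l)"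
proof -
  have "has_bochner_integral lborel (\<lambda>t. indicator {0..h} t *\<^sub>R exp (- l * t))
      ((\<lambda>t. - exp (- l * t) / l) h - (\<lambda>t. - exp (- l * t) / l) 0)"
    using assms by (intro has_bochner_integral_FTC_Icc)
      (auto intro!: derivative_eq_intros continuous_intros simp flip: has_real_derivative_iff_has_vector_derivative)
  then show ?thesis
    by (simp add: diff_divide_distrib)
qed

text \<open>The first bound drops the discount factor, for the comparison with undiscounted
  integrals. The second replaces \<open>f\<close> by 1 and leaves the mass of the discount, for the
  uniform bound on subsolutions.\<close>

lemma discounted_integral_le:
  fixes f :: "real \<Rightarrow> real"
  assumes f: "f \<in> borel_measurable (restrict_space borel {0..})"
    and f01: "\<And>t. f t \<in> {0..1}"
    and "l > 0" "h \<ge> 0"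
  shows "l * (LBINT t:{0..h}. exp (- l * t) * f t) \<le> l * (LBINT t:{0..h}. f t)"
    and "l * (LBINT t:{0..h}. exp (- l * t) * f t) \<le> 1 - exp (- l * h)"
proof -
  have i1: "set_integrable lborel {0..h} (\<lambda>t. exp (- l * t) * f t)"
    using assms by (intro set_integrable_weighted) auto
  have i2: "set_integrable lborel {0..h} f"
    using set_integrable_weighted[OF f f01, of "\<lambda>_. 1" h] by simp
  have i3: "has_bochner_integral lborel (\<lambda>t. indicator {0..h} t *\<^sub>R exp (- l * t)) ((1 - exp (- l * h)) / l)"
    by (rule has_bochner_integral_exp_neg_Icc) fact+
  have "(LBINT t:{0..h}. exp (- l * t) * f t) \<le> (LBINT t:{0..h}. f t)"
    by (intro set_integral_mono i1 i2 mult_left_le_one_le) (use f01 \<open>l > 0\<close> in auto)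
  then show "l * (LBINT t:{0..h}. exp (- l * t) * f t) \<le> l * (LBINT t:{0..h}. f t)"
    using \<open>l > 0\<close> by simp
  have "(LBINT t:{0..h}. exp (- l * t) * f t) \<le> (LBINT t:{0..h}. exp (- l * t))"
  proof (intro set_integral_mono i1)
    show "set_integrable lborel {0..h} (\<lambda>t. exp (- l * t))"
      using i3 by (auto simp: set_integrable_def has_bochner_integral_iff)
  qed (use f01 in \<open>auto intro: mult_right_le_one_le\<close>)
  also have "\<dots> = (1 - exp (- l * h)) / l"
    using i3 by (auto simp: set_lebesgue_integral_def has_bochner_integral_iff)
  finally show "l * (LBINT t:{0..h}. exp (- l * t) * f t) \<le> 1 - exp (- l * h)"
    using \<open>l > 0\<close> by (simp add: field_simps)
qed

lemma set_integral_unit_bounds: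
  fixes f :: "real \<Rightarrow> real"
  assumes f: "f \<in> borel_measurable (restrict_space borel {0..})"
    and f01: "\<And>t. f t \<in> {0..1}"
    and "0 \<le> S" "S \<le> T"
  shows "0 \<le> (LBINT t:{0..S}. f t)" "(LBINT t:{0..S}. f t) \<le> S"
    and "(LBINT t:{0..S}. f t) \<le> (LBINT t:{0..T}. f t)"
proof -
  have i: "set_integrable lborel {0..h} f" for h
    using set_integrable_weighted[OF f f01, of "\<lambda>_. 1" h] by simp
  show "0 \<le> (LBINT t:{0..S}. f t)"
    unfolding set_lebesgue_integral_def
    by (rule integral_nonneg_AE) (use f01 in \<open>auto simp: indicator_def\<close>)
  have "(LBINT t:{0..S}. f t) \<le> (LBINT t:{0..S}. 1)"
    by (intro set_integral_mono i) (use f01 in \<open>auto intro: borel_integrable_atLeastAtMost'\<close>)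
  then show "(LBINT t:{0..S}. f t) \<le> S"
    using \<open>0 \<le> S\<close> by (simp add: set_lebesgue_integral_def)
  show "(LBINT t:{0..S}. f t) \<le> (LBINT t:{0..T}. f t)"
    unfolding set_lebesgue_integral_def
    by (rule integral_mono)
      (use i \<open>S \<le> T\<close> f01 in \<open>auto simp: set_integrable_def indicator_def split: if_splits\<close>)
qed

section \<open>Consequences of the game value axioms\<close>

text \<open>Compatibility with adding a constant (the affine axiom with factor 1) turns monotonicity
  into a transfer of payoff estimates with error to values.\<close>

lemma game_value_le_add:
  assumes "payoff_class K C" "game_value_map K C V" "c1 \<in> C" "c2 \<in> C"
    and "\<And>z. z \<in> K \<Longrightarrow> c1 z \<le> c2 z + B"
  shows "V c1 \<omega> \<le> V c2 \<omega> + B"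
proof -
  let ?c = "\<lambda>z\<in>K. 1 * c2 z + B"
  have "?c \<in> C"
    using assms(1,4) zero_le_one unfolding payoff_class_def by blast
  then have "V c1 \<omega> \<le> V ?c \<omega>"
    using assms(2,3,5) unfolding game_value_map_def by simp
  also have "V ?c = (\<lambda>\<omega>. 1 * V c2 \<omega> + B)"
    using assms(2,4) zero_le_one unfolding game_value_map_def by blast
  finally show ?thesis
    by simp
qed

lemma game_value_const:
  assumes "payoff_class K C" "game_value_map K C V"
  shows "(\<lambda>z\<in>K. B) \<in> C" "V (\<lambda>z\<in>K. B) \<omega> = B"
proof -
  obtain c where "c \<in> C"
    using assms(1) unfolding payoff_class_def by blast
  \<comment> \<open>The factor 0 erases an arbitrary payoff \<open>c\<close> and leaves the
    constant.\<close>
  then have "(\<lambda>z\<in>K. 0 * c z + B) \<in> C" "V (\<lambda>z\<in>K. 0 * c z + B) = (\<lambda>\<omega>. 0 * V c \<omega> + B)"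
    using assms unfolding payoff_class_def game_value_map_def by blast+
  then show "(\<lambda>z\<in>K. B) \<in> C" "V (\<lambda>z\<in>K. B) \<omega> = B"
    by simp_all
qed

section \<open>Comparison of discounted and averaged payoffs\<close>

lemma exp_minus_le_quadratic:
  fixes q :: real
  assumes "0 \<le> q"
  shows "exp (- q) \<le> 1 - q + q\<^sup>2 / 2"
proof (cases "q = 0")
  case False
  then obtain t where t: "exp (- q) = (\<Sum>m<3. (- q) ^ m / fact m) + exp t / fact 3 * (- q) ^ 3" "\<bar>t\<bar> \<le> \<bar>- q\<bar>"
    using Maclaurin_exp_le[of "- q" 3] by blast
  \<comment> \<open>The cubic Lagrange remainder has the sign of \<open>(- q) ^ 3\<close>.\<close>
  have "exp t / fact 3 * (- q) ^ 3 \<le> 0"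
    using assms by (auto simp: mult_le_0_iff)
  then show ?thesis
    using t by (simp add: numeral_3_eq_3 power2_eq_square)
qed auto

text \<open>The horizon \<open>h\<close> in the subsolution property can be taken so large that the terminal term
  becomes negligible.\<close>

lemma abel_subsolution_le_2:
  assumes g01: "\<And>\<omega>. g \<omega> \<in> {0..1}"
    and meas: "\<And>z. z \<in> K \<Longrightarrow> (\<lambda>t. g (z t)) \<in> borel_measurable (restrict_space borel {0..})"
    and pc: "payoff_class K C" and gv: "game_value_map K C V"
    and sub: "abel_subsolution K g C V U"
  obtains Tb :: nat where "Tb > 0" "\<And>l \<omega>. 0 < l \<Longrightarrow> l < 1 / real Tb \<Longrightarrow> U l \<omega> \<le> 2"
proof -
  have half: "(0::real) < 1 / 2"
    by simp
  obtain Tb :: nat where "Tb > 0" and Tb: "\<And>h l. h > Tb \<Longrightarrow> 0 < l \<Longrightarrow> l < 1 / real Tb \<Longrightarrow>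
      abel_aux K g (U l) (real h) l \<in> C \<and>
      (\<forall>\<omega>. U l \<omega> \<le> V (abel_aux K g (U l) (real h) l) \<omega> + 1 / 2)"
    using sub half unfolding abel_subsolution_def by meson
  have "U l \<omega> \<le> 2" if l: "0 < l" "l < 1 / real Tb" for l \<omega>
  proof -
    have "bounded (range (U l))"
      using sub l unfolding abel_subsolution_def bounded_maps_def by auto
    then obtain M where M: "\<And>\<omega>. \<bar>U l \<omega>\<bar> \<le> M"
      by (auto simp: bounded_iff)
    have "M \<ge> 0"
      using M[of undefined] by linarith
    have "(\<lambda>h. exp (- l * real h) * M) \<longlonglongrightarrow> 0"
      using l by real_asymp
    then have "\<forall>\<^sub>F h in sequentially. exp (- l * real h) * M < 1 / 2"
      by (rule order_tendstoD) simp
    \<comment> \<open>The bound \<open>M\<close> depends on \<open>l\<close>, and \<open>h\<close>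
      is chosen after both. So \<open>M\<close> does not enter the final bound, and the threshold
      \<open>Tb\<close> stays independent of \<open>l\<close>.\<close>
    then obtain h where h: "h > Tb" "exp (- l * real h) * M < 1 / 2"
      using eventually_conj[OF _ eventually_gt_at_top[of Tb]] eventually_sequentially
      by (metis (mono_tags, lifting) eventually_happens trivial_limit_sequentially)
    \<comment> \<open>The running part is at most 1 and the terminal part at most 1/2; the tolerance
      1/2 of the subsolution property then completes the bound 2.\<close>
    have "V (abel_aux K g (U l) (real h) l) \<omega> \<le> V (\<lambda>z\<in>K. 3 / 2) \<omega> + 0"
    proof (rule game_value_le_add[OF pc gv])
      fix z assume z: "z \<in> K"
      have "exp (- l * real h) * U l (z (real h)) \<le> exp (- l * real h) * M"
        using M[of "z (real h)"] by (intro mult_left_mono) auto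
      moreover have "l * (LBINT t:{0..real h}. exp (- l * t) * g (z t)) \<le> 1 - exp (- l * real h)"
        using discounted_integral_le(2)[OF meas[OF z] g01 l(1)] by simp
      moreover have "exp (- l * real h) > 0"
        by simp
      ultimately have "l * (LBINT t:{0..real h}. exp (- l * t) * g (z t))
          + exp (- l * real h) * U l (z (real h)) \<le> 3 / 2"
        using h(2) by linarith
      then show "abel_aux K g (U l) (real h) l z \<le> (\<lambda>z\<in>K. 3 / 2) z + 0"
        using z by (simp add: abel_aux_def)
    qed (use Tb[OF h(1) l] game_value_const[OF pc gv] in auto)
    also have "\<dots> = 3 / 2"
      by (simp add: game_value_const[OF pc gv])
    finally show ?thesis
      using Tb[OF h(1) l] by (smt (verit) field_sum_of_halves)
  qed
  with \<open>Tb > 0\<close> show ?thesis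
    using that by blast
qed

text \<open>At rate \<open>1 / (T + h)\<close> both running parts carry the same prefactor, so
  dropping the discount compares them. Only the terminal weights \<open>exp (- q)\<close> and
  \<open>1 - q\<close> differ.\<close>

lemma abel_aux_le_cesaro_aux:
  fixes h T :: real
  assumes g01: "\<And>\<omega>. g \<omega> \<in> {0..1}"
    and meas: "(\<lambda>t. g (z t)) \<in> borel_measurable (restrict_space borel {0..})"
    and z: "z \<in> K" and hT: "h > 0" "T > 0"
    and u2: "u (z h) \<le> 2" and uv: "u (z h) \<le> v (z h) + D"
  shows "abel_aux K g u h (1 / (T + h)) z
    \<le> cesaro_aux K g v h T z + ((1 - h / (T + h)) * D + (h / (T + h))\<^sup>2)"
proof -
  define q where "q = h / (T + h)"
  have q: "0 \<le> q" "q \<le> 1" and q': "T / (T + h) = 1 - q"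
    using hT by (auto simp: q_def field_simps)
  \<comment> \<open>The bound by \<open>v + D\<close> is used with weight \<open>1 - q\<close>, the
    bound 2 only with the excess weight, which lies between 0 and half of \<open>q\<close>
    squared.\<close>
  have "exp (- q) * u (z h) = (1 - q) * u (z h) + (exp (- q) - (1 - q)) * u (z h)"
    by (simp add: algebra_simps)
  also have "\<dots> \<le> (1 - q) * (v (z h) + D) + (exp (- q) - (1 - q)) * 2"
    using q uv u2 exp_ge_add_one_self[of "- q"] by (intro add_mono mult_left_mono) auto
  also have "\<dots> \<le> (1 - q) * (v (z h) + D) + q\<^sup>2"
    using exp_minus_le_quadratic[OF q(1)] by simp
  finally show ?thesis
    using discounted_integral_le(1)[OF meas g01, of "1 / (T + h)" h] hT z
    unfolding abel_aux_def cesaro_aux_def q_def[symmetric] q'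
    by (simp add: algebra_simps flip: q_def)
qed

text \<open>Used to pass from a real horizon to its integer part: the average up to \<open>S\<close>
  is at most 1, and \<open>1 / S\<close> exceeds \<open>1 / T\<close> by
  \<open>(T - S) / (T * S)\<close>.\<close>

lemma cesaro_payoff_le:
  assumes g01: "\<And>\<omega>. g \<omega> \<in> {0..1}"
    and meas: "(\<lambda>t. g (z t)) \<in> borel_measurable (restrict_space borel {0..})"
    and z: "z \<in> K" and ST: "0 < S" "S \<le> T" "T \<le> S + 1"
  shows "cesaro_payoff K g S z \<le> cesaro_payoff K g T z + 1 / T"
proof -
  let ?I = "LBINT t:{0..S}. g (z t)"
  have I: "0 \<le> ?I" "?I \<le> S" "?I \<le> (LBINT t:{0..T}. g (z t))"
    using set_integral_unit_bounds[OF meas g01, of S T] ST by auto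
  have "1 / S * ?I = 1 / T * ?I + (T - S) / T * (?I / S)"
    using ST by (simp add: field_simps)
  also have "\<dots> \<le> 1 / T * (LBINT t:{0..T}. g (z t)) + 1 / T * 1"
    using I ST by (intro add_mono mult_left_mono mult_mono divide_right_mono) auto
  finally show ?thesis
    using z by (simp add: cesaro_payoff_def)
qed

section \<open>Uniform slow variation and the abstract contraction\<close>

lemma Limsup_SUP_le_0D:
  fixes U :: "real \<Rightarrow> 'w \<Rightarrow> real"
  assumes "Limsup (at_right 0)
      (\<lambda>l::real. SUP p\<in>{1..p0}. SUP \<omega>. ereal (U l \<omega> - U (p * l) \<omega>)) \<le> 0" and "e > 0"
  obtains b :: real where "b > 0"
    "\<And>l p \<omega>. 0 < l \<Longrightarrow> l < b \<Longrightarrow> 1 \<le> p \<Longrightarrow> p \<le> p0 \<Longrightarrow> U l \<omega> \<le> U (p * l) \<omega> + e"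
proof -
  have "\<forall>\<^sub>F l in at_right 0. (SUP p\<in>{1..p0}. SUP \<omega>. ereal (U l \<omega> - U (p * l) \<omega>)) < ereal e"
    using assms by (intro Limsup_lessD) (auto intro: le_less_trans)
  then obtain b where b: "b > 0"
    "\<And>l. 0 < l \<Longrightarrow> l < b \<Longrightarrow> (SUP p\<in>{1..p0}. SUP \<omega>. ereal (U l \<omega> - U (p * l) \<omega>)) < ereal e"
    unfolding eventually_at_right_field by blast
  have "U l \<omega> \<le> U (p * l) \<omega> + e" if "0 < l" "l < b" "1 \<le> p" "p \<le> p0" for l p \<omega>
  proof -
    have "ereal (U l \<omega> - U (p * l) \<omega>) \<le> (SUP p\<in>{1..p0}. SUP \<omega>. ereal (U l \<omega> - U (p * l) \<omega>))"
      using that by (intro SUP_upper2[of p] SUP_upper2[of \<omega>]) auto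
    also have "\<dots> < ereal e"
      using b that by blast
    finally show ?thesis
      by simp
  qed
  with b(1) show ?thesis
    using that by blast
qed

text \<open>\<open>P n D\<close> stands for "\<open>D\<close> bounds the gap at \<open>n\<close>".
  The step is a convex combination with \<open>L\<close>, so it multiplies the excess over
  \<open>L\<close> by \<open>1 - q\<close>. Since \<open>q\<close> is at least
  \<open>1 / (2 * m)\<close> for large \<open>n\<close>, finitely many steps bring the excess below
  any positive \<open>\<delta>\<close>.\<close>

lemma contraction_along_div:
  fixes P :: "nat \<Rightarrow> real \<Rightarrow> bool" and B L :: real
  assumes m: "m \<ge> 2" and B: "B \<ge> 0"
    and mono: "\<And>n D D'. P n D \<Longrightarrow> D \<le> D' \<Longrightarrow> P n D'"
    and base: "\<And>n. n \<ge> N0 \<Longrightarrow> P n (L + B)"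
    and step: "\<And>n D q. n \<ge> N0 \<Longrightarrow> q = real (n div m) / real n \<Longrightarrow> P (n - n div m) D
      \<Longrightarrow> P n ((1 - q) * D + q * L)"
    and "\<delta> > 0"
  shows "\<exists>N. \<forall>n\<ge>N. P n (L + \<delta>)"
proof -
  define r where "r = 1 - 1 / (2 * real m)"
  have r: "0 \<le> r" "r < 1"
    using m by (auto simp: r_def field_simps)
  have iter: "\<exists>N. \<forall>n\<ge>N. P n (L + r ^ k * B)" for k
  proof (induction k)
    case 0
    then show ?case
      using base by auto
  next
    case (Suc k)
    then obtain N where N: "\<And>n. n \<ge> N \<Longrightarrow> P n (L + r ^ k * B)"
      by blast
    \<comment> \<open>\<open>n \<ge> m\<close> makes \<open>n div m\<close> positive, so rounding
      down costs at most a factor 2 in \<open>q\<close>; \<open>n \<ge> 2 * N\<close> keeps the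
      earlier index \<open>n - n div m\<close> above \<open>N\<close>.\<close>
    have "P n (L + r ^ Suc k * B)" if n: "n \<ge> max N0 (max m (2 * N))" for n
    proof -
      define q where "q = real (n div m) / real n"
      have "n div m \<le> n div 2"
        using m by (intro div_le_mono2) auto
      then have "n - n div m \<ge> N"
        using n by linarith
      moreover have "n \<ge> N0"
        using n by simp
      ultimately have P: "P n ((1 - q) * (L + r ^ k * B) + q * L)"
        using step[OF _ q_def] N by blast
      have "n div m \<ge> 1"
        using n m by (simp add: div_greater_zero_iff Suc_le_eq)
      then have "m * Suc (n div m) \<le> m * (2 * (n div m))"
        by (intro mult_left_mono) auto
      moreover have "n < m * Suc (n div m)"
        using m dividend_less_times_div[of m n] by simp
      ultimately have "n \<le> 2 * m * (n div m)"
        by linarith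
      then have "real n \<le> 2 * real m * real (n div m)"
        by (metis of_nat_le_iff of_nat_mult of_nat_numeral)
      then have "1 - q \<le> r"
        using n m by (simp add: q_def r_def field_simps)
      then have "(1 - q) * (r ^ k * B) \<le> r * (r ^ k * B)"
        using r B by (intro mult_right_mono) auto
      then have "(1 - q) * (L + r ^ k * B) + q * L \<le> L + r ^ Suc k * B"
        by (simp add: algebra_simps)
      with P show ?thesis
        by (rule mono)
    qed
    then show ?case
      by blast
  qed
  have "(\<lambda>k. r ^ k * B) \<longlonglongrightarrow> 0"
    using r by (intro tendsto_mult_left_zero LIMSEQ_power_zero) auto
  then have "\<forall>\<^sub>F k in sequentially. r ^ k * B < \<delta>"
    using \<open>\<delta> > 0\<close> by (rule order_tendstoD)
  then obtain k where "r ^ k * B < \<delta>"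
    by (auto simp: eventually_sequentially)
  then show ?thesis
    using iter[of k] mono by (meson add_left_mono less_imp_le)
qed

section \<open>Comparison of the subsolution with the Cesaro values\<close>

theorem proposition2:
  fixes K :: "(real \<Rightarrow> 'w) set"
    and g :: "'w \<Rightarrow> real"
    and C :: "((real \<Rightarrow> 'w) \<Rightarrow> real) set"
    and V :: "((real \<Rightarrow> 'w) \<Rightarrow> real) \<Rightarrow> 'w \<Rightarrow> real"
    and U :: "real \<Rightarrow> 'w \<Rightarrow> real"
  assumes "K \<noteq> {}" and "K \<subseteq> ({0..} \<rightarrow>\<^sub>E UNIV)"
    and "\<And>\<omega>. g \<omega> \<in> {0..1}"
    and "\<And>z. z \<in> K \<Longrightarrow> (\<lambda>t. g (z t)) \<in> borel_measurable (restrict_space borel {0..})"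
    and "payoff_class K C"
    and "game_value_map K C V"
    and "\<And>T. T > 0 \<Longrightarrow> cesaro_payoff K g T \<in> C"
    and "\<And>l. l > 0 \<Longrightarrow> abel_payoff K g l \<in> C"
    and "abel_subsolution K g C V U"
    and "cesaro_supersolution K g C V (\<lambda>T. V (cesaro_payoff K g T))"
    and "\<And>p0. p0 > 1 \<Longrightarrow>
           Limsup (at_right 0)
             (\<lambda>l::real. SUP p\<in>{1..p0}. SUP \<omega>. ereal (U l \<omega> - U (p * l) \<omega>)) \<le> 0"
  shows "\<forall>\<epsilon>>0. \<exists>N::nat. \<forall>T::real. T > real N \<longrightarrow>
           (\<forall>\<omega>. V (cesaro_payoff K g T) \<omega> \<ge> U (1 / T) \<omega> - \<epsilon>)"
proof (intro allI impI)
  fix \<epsilon> :: real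
  assume "\<epsilon> > 0"
  note g01 = assms(3) and meas = assms(4) and pc = assms(5) and gv = assms(6)
    and ces = assms(7) and sub = assms(9) and sup = assms(10)
  let ?V = "\<lambda>T. V (cesaro_payoff K g T)"
  obtain m0 :: nat where m0: "8 / \<epsilon> < real m0"
    using reals_Archimedean2 by blast
  define m where "m = max 2 m0"
  have "8 / \<epsilon> < real m"
    using m0 by (simp add: m_def)
  then have m: "m \<ge> 2" "1 / real m \<le> \<epsilon> / 8"
    using \<open>\<epsilon> > 0\<close> by (auto simp: m_def field_simps)
  \<comment> \<open>One step costs at most \<open>3 * e\<close>: one \<open>e\<close> each from the
    subsolution, the supersolution and the change of rate. As \<open>1 \<le> 2 * m * q\<close>, this
    is at most \<open>q * (6 * m * e)\<close>, the second summand of \<open>L\<close>; the first one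
    absorbs the square of \<open>q\<close> through \<open>q \<le> 1 / m\<close>.\<close>
  define e where "e = \<epsilon> / (64 * real m)"
  have e: "e > 0" "6 * real m * e \<le> \<epsilon> / 8" "e \<le> \<epsilon> / 8"
    using m(1) \<open>\<epsilon> > 0\<close> by (auto simp: e_def field_simps)
  define L where "L = 1 / real m + 6 * real m * e"
  have L: "0 \<le> L" "L \<le> \<epsilon> / 4"
    using m e by (auto simp: L_def)
  obtain T0 :: nat where T0: "T0 > 0" "\<And>l \<omega>. 0 < l \<Longrightarrow> l < 1 / real T0 \<Longrightarrow> U l \<omega> \<le> 2"
    using abel_subsolution_le_2[OF g01 meas pc gv sub] by blast
  obtain T1 :: nat where T1: "T1 > 0" "\<And>h l. h > T1 \<Longrightarrow> 0 < l \<Longrightarrow> l < 1 / real T1 \<Longrightarrow>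
      abel_aux K g (U l) (real h) l \<in> C \<and>
      (\<forall>\<omega>. U l \<omega> \<le> V (abel_aux K g (U l) (real h) l) \<omega> + e)"
    using sub e(1) unfolding abel_subsolution_def by meson
  obtain T2 :: nat where T2: "T2 > 0" "\<And>h T. h > T2 \<Longrightarrow> T > T2 \<Longrightarrow>
      cesaro_aux K g (?V (real T)) (real h) (real T) \<in> C \<and>
      (\<forall>\<omega>. ?V (real T + real h) \<omega> \<ge> V (cesaro_aux K g (?V (real T)) (real h) (real T)) \<omega> - e)"
    using sup e(1) unfolding cesaro_supersolution_def by meson
  \<comment> \<open>Ratio 2 is enough: both \<open>n / T\<close> with \<open>n \<le> 2 * T\<close>
    and \<open>T / n\<close> with \<open>n\<close> the integer part of \<open>T\<close> stay within
    it.\<close>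
  obtain b where b: "b > 0"
    "\<And>l p \<omega>. 0 < l \<Longrightarrow> l < b \<Longrightarrow> 1 \<le> p \<Longrightarrow> p \<le> 2 \<Longrightarrow> U l \<omega> \<le> U (p * l) \<omega> + e"
    using Limsup_SUP_le_0D[OF assms(11)[of 2] e(1)] by auto
  obtain T3 :: nat where T3: "1 / b < real T3"
    using reals_Archimedean2 by blast
  \<comment> \<open>The summand 1 makes \<open>N1\<close> strictly exceed each threshold; the factor
    \<open>2 * m\<close> in \<open>N0\<close> keeps even \<open>h = n div m\<close> above
    \<open>N1\<close>.\<close>
  define N1 where "N1 = T0 + T1 + T2 + T3 + 1"
  define N0 where "N0 = 2 * m * N1"
  have small: "1 / T < 1 / real T0" "1 / T < 1 / real T1" "1 / T < b" if "T \<ge> real N1" for T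
  proof -
    have "real T0 < T" "real T1 < T" "1 / b < T"
      using that T3 by (auto simp: N1_def)
    then show "1 / T < 1 / real T0" "1 / T < 1 / real T1" "1 / T < b"
      using T0(1) T1(1) b(1) by (auto simp: field_simps intro!: divide_strict_left_mono)
  qed
  \<comment> \<open>With the upper bound 2 on \<open>U\<close>, this supplies the initial gap 2 for
    the iteration.\<close>
  have V0: "?V T \<omega> \<ge> 0" if "T > 0" for T \<omega>
  proof -
    have "V (\<lambda>z\<in>K. 0) \<omega> \<le> ?V T \<omega> + 0"
    proof (rule game_value_le_add[OF pc gv])
      fix z assume z: "z \<in> K"
      show "(\<lambda>z\<in>K. 0) z \<le> cesaro_payoff K g T z + 0"
        using set_integral_unit_bounds(1)[OF meas[OF z] g01, of T T] that z
        by (simp add: cesaro_payoff_def)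
    qed (use game_value_const[OF pc gv] ces that in auto)
    then show ?thesis
      by (simp add: game_value_const[OF pc gv])
  qed
  define P where "P = (\<lambda>n D. \<forall>\<omega>. U (1 / real n) \<omega> \<le> ?V (real n) \<omega> + D)"
  have "\<exists>N. \<forall>n\<ge>N. P n (L + \<epsilon> / 4)"
  proof (rule contraction_along_div[OF m(1), of 2 P N0 L])
    show "P n D'" if "P n D" "D \<le> D'" for n D D'
      using that unfolding P_def by (meson add_left_mono order_trans)
    show "P n (L + 2)" if n: "n \<ge> N0" for n
      unfolding P_def
    proof
      fix \<omega>
      have "N1 \<le> N0"
        using m(1) by (simp add: N0_def)
      then have "real n \<ge> real N1" "n > 0"
        using n by (auto simp: N1_def)
      then show "U (1 / real n) \<omega> \<le> ?V (real n) \<omega> + (L + 2)"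
        using T0(2)[of "1 / real n" \<omega>] small(1)[of "real n"] V0[of "real n" \<omega>] L(1) by auto
    qed
    show "P n ((1 - q) * D + q * L)"
      if n: "n \<ge> N0" and q: "q = real (n div m) / real n" and PT: "P (n - n div m) D" for n D q
      unfolding P_def
    proof
      fix \<omega>
      define h where "h = n div m"
      define T where "T = n - n div m"
      have "n div m \<le> n div 2"
        using m(1) by (intro div_le_mono2) auto
      then have nT: "n = T + h" "n \<le> 2 * T"
        by (auto simp: T_def h_def)
      have "N0 div m = 2 * N1"
        using m(1) by (simp add: N0_def)
      then have "2 * N1 \<le> h"
        using div_le_mono[OF n, of m] by (simp add: h_def)
      moreover have "h \<le> T"
        using nT by linarith
      ultimately have hT: "h \<ge> N1" "T \<ge> N1" and pos: "N1 > 0" "h > 0" "T > 0"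
        by (auto simp: N1_def)
      have nN: "real n = real T + real h" "real n \<ge> real N1" "real n > 0"
        using hT nT pos by auto
      let ?l = "1 / (real T + real h)"
      have l: "?l > 0" "?l < 1 / real T0" "?l < 1 / real T1" "?l < b"
        using small[OF nN(2)] nN by auto
      have q': "q = real h / (real T + real h)" "0 < q" "q \<le> 1"
        using nN pos by (auto simp: q h_def)
      \<comment> \<open>The terminal term has rate \<open>1 / n\<close>, whereas the bound
        \<open>D\<close> at horizon \<open>T\<close> concerns rate \<open>1 / T\<close>. Slow
        variation with ratio \<open>n / T\<close> bridges the two.\<close>
      have Un: "U ?l \<omega>' \<le> ?V (real T) \<omega>' + (D + e)" for \<omega>'
      proof -
        have "1 \<le> real n / real T" "real n / real T \<le> 2"
          using nT pos by (auto simp: field_simps)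
        then have "U ?l \<omega>' \<le> U (real n / real T * ?l) \<omega>' + e"
          using l by (intro b) auto
        also have "real n / real T * ?l = 1 / real T"
          using nN by simp
        finally show ?thesis
          using PT unfolding P_def T_def[symmetric] by (smt (verit))
      qed
      have A: "abel_aux K g (U ?l) (real h) ?l \<in> C"
        "U ?l \<omega> \<le> V (abel_aux K g (U ?l) (real h) ?l) \<omega> + e"
        using T1(2)[of h ?l] l hT by (auto simp: N1_def)
      have Z: "cesaro_aux K g (?V (real T)) (real h) (real T) \<in> C"
        "V (cesaro_aux K g (?V (real T)) (real h) (real T)) \<omega> \<le> ?V (real T + real h) \<omega> + e"
        using T2(2)[of h T] hT by (auto simp: N1_def algebra_simps)
      have AZ: "V (abel_aux K g (U ?l) (real h) ?l) \<omega>
          \<le> V (cesaro_aux K g (?V (real T)) (real h) (real T)) \<omega> + ((1 - q) * (D + e) + q\<^sup>2)"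
        unfolding q'(1)
        by (rule game_value_le_add[OF pc gv A(1) Z(1)], rule abel_aux_le_cesaro_aux[OF g01 meas])
          (use pos Un T0(2)[OF l(1,2)] in auto)
      have "q \<le> 1 / real m"
        using nN m(1) of_nat_div_le_of_nat[of n m, where ?'a = real] by (simp add: q field_simps)
      then have "q * q \<le> q * (1 / real m)"
        using q' by (intro mult_left_mono) auto
      moreover have "1 \<le> 2 * real m * q"
      proof -
        have "n < m * Suc h"
          using m(1) dividend_less_times_div[of m n] by (simp add: h_def)
        also have "\<dots> \<le> m * (2 * h)"
          using pos by (intro mult_left_mono) auto
        finally have "real n \<le> real (m * (2 * h))"
          by (simp only: of_nat_le_iff less_imp_le)
        then show ?thesis
          using nN by (simp add: q h_def field_simps)
      qed
      then have "1 * (3 * e) \<le> 2 * real m * q * (3 * e)"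
        using e by (intro mult_right_mono) auto
      moreover have "0 \<le> q * e"
        using q' e by simp
      \<comment> \<open>The errors \<open>(1 - q) * e + 2 * e\<close> are at most
        \<open>3 * e\<close>, hence fit into \<open>q * L\<close> beside the square of
        \<open>q\<close>.\<close>
      ultimately have "(1 - q) * (D + e) + q\<^sup>2 + 2 * e \<le> (1 - q) * D + q * L"
        by (simp add: L_def power2_eq_square algebra_simps)
      then show "U (1 / real n) \<omega> \<le> ?V (real n) \<omega> + ((1 - q) * D + q * L)"
        using A(2) AZ Z(2) unfolding nN(1) by linarith
    qed
  qed (use \<open>\<epsilon> > 0\<close> in auto)
  then obtain N where N: "\<And>n. n \<ge> N \<Longrightarrow> P n (L + \<epsilon> / 4)"
    by blast
  obtain N2 :: nat where N2: "8 / \<epsilon> < real N2"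
    using reals_Archimedean2 by blast
  \<comment> \<open>Real horizons reduce to the integer part \<open>n\<close>: slow variation moves
    \<open>U\<close>, the comparison of nearby averages moves the value. The total error is at most
    \<open>3 * \<epsilon> / 4\<close>: \<open>\<epsilon> / 8\<close> from each move,
    \<open>\<epsilon> / 4\<close> from \<open>L\<close>, and \<open>\<epsilon> / 4\<close> from the
    iteration.\<close>
  have "?V T \<omega> \<ge> U (1 / T) \<omega> - \<epsilon>" if T: "T > real (N + N1 + N2)" for T \<omega>
  proof -
    define n where "n = nat \<lfloor>T\<rfloor>"
    have n: "real n \<le> T" "T \<le> real n + 1" "n \<ge> N + N1 + N2"
      using T unfolding n_def by (auto simp: le_nat_floor)
    have n1: "real n \<ge> 1"
      using n(3) by (simp add: N1_def)
    have "U (1 / T) \<omega> \<le> U (T / real n * (1 / T)) \<omega> + e"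
      using n n1 small(3)[of T] T by (intro b) (auto simp: field_simps)
    also have "T / real n * (1 / T) = 1 / real n"
      using n n1 by simp
    also have "U (1 / real n) \<omega> \<le> ?V (real n) \<omega> + (L + \<epsilon> / 4)"
      using N[of n] n(3) unfolding P_def by simp
    also have "?V (real n) \<omega> \<le> ?V T \<omega> + 1 / T"
      using n n1 by (intro game_value_le_add[OF pc gv] ces cesaro_payoff_le[OF g01 meas]) auto
    finally have "U (1 / T) \<omega> \<le> ?V T \<omega> + 1 / T + (L + \<epsilon> / 4) + e"
      by linarith
    moreover have "1 / T \<le> \<epsilon> / 8"
    proof -
      have "8 / \<epsilon> < T"
        using T N2 by simp
      then show ?thesis
        using \<open>\<epsilon> > 0\<close> n n1 by (simp add: field_simps)
    qed
    ultimately show ?thesis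
      using L(2) e(3) \<open>\<epsilon> > 0\<close> by linarith
  qed
  then show "\<exists>N::nat. \<forall>T::real. T > real N \<longrightarrow> (\<forall>\<omega>. ?V T \<omega> \<ge> U (1 / T) \<omega> - \<epsilon>)"
    by blast
qed

end
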